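(* Let $\alpha,\beta\in(0,1)$ satisfy $\tfrac12\le\alpha\le\tfrac23$, $\alpha+\beta<1$ and $\beta\ge1-\sqrt{1-\alpha}-\alpha/2$, and assume the imported per-phase facts (see context). For every queue $q$ with $\hat e_q>0$, put $b_0=\lceil\sigma_{q,i_q}\rceil-1$ and $m=b_0+\hat e_q$, and for a non-decreasing sequence of positive reals $b_0\le b_1\le\dots\le b_m$ put $$D(b_0,\dots,b_m)=\sum_{j=0}^{b_0-1}\frac{\alpha(b_{j+1}-b_j)+1}{b_j}\,\hat e_q+\sum_{j=b_0}^{m-1}\Bigl(\frac{\alpha(b_{j+1}-b_j)+1}{b_j}(\hat e_q+b_0-j)-\frac1{2b_j}\Bigr).$$ Then the splitting scheme assigns $q$ a total payment of at least $$(1-\alpha-\beta)\,b_0+D(b_0,\dots,b_m)-\tfrac12$$ where $(b_j)$ is the running-max envelope of $q$ (see context). Consequently $$\mathrm{payment}_q\ \ge\ (1-\alpha-\beta)\,b_0+\inf D(b_0,b_1,\dots,b_m)-\tfrac12 ,$$ the infimum being over all non-decreasing real sequences with initial value $b_0$.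
   Context: Switch. $N$ queues share a buffer of size $B$, initially empty. In each step packets arrive, the policy admits/rejects/evicts so that at most $B$ packets are stored, then every nonempty queue transmits one packet. LQD resolves every excess by repeatedly evicting a packet from a currently longest queue (ties broken by an arbitrary tie rule). Fix an instance and run LQD and an optimal offline schedule OPT side by side. $s^t_{\mathrm{LQD}}(q)$, $s^t_{\mathrm{OPT}}(q)$ are the sizes of queue $q$ at step $t$ after arrivals and evictions, before transmission; $s^t_{\max}=\max_q s^t_{\mathrm{LQD}}(q)$. Standing assumption (A1): if $s^t_{\mathrm{LQD}}(q)\le1$ and $q$ has received a packet at or before $t$, then nothing arrives to $q$ after $t$. Debts. OPT transmits an OPT-extra packet from $q$ at $t$ if it transmits from $q$ while LQD's copy of $q$ is empty; LQD-extra packets are defined symmetrically. $e_q$ (resp. $e_q^t$) is the number of OPT-extra packets transmitted from $q$ in total (resp. at step $t$ or later). A mapping procedure supplies integers $0\le m_q\le e_q$ with $\sum_q m_q$ at most the total number of LQD-extra packets. $\hat e_q=e_q-m_q$, $\hat e_q^t=\max\{e_q^t-m_q,0\}$. Phases. Queue $q$ overflows at step $t$ if a packet destined to $q$ is evicted by LQD at $t$, or if LQD's buffer is full and $s^t_{\mathrm{LQD}}(q)\ge\max\{s^t_{\max}-1,1\}$. The key step $t_q$ is the last step at which $q$ overflows ($-1$ if none). $\tau_1<\dots<\tau_\ell$ are the distinct last-overflow steps over all queues, $\tau_{\ell+1}=T+1$ with $T$ the last active step; phase $i$ is $[\tau_i,\tau_{i+1})$. A subscript $i$ on a step-dependent quantity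 means its value at $\tau_i$, e.g. $\hat e_{q,i}=\hat e_q^{\tau_i}$. $i_q$ is the phase containing $t_q$. The pending window of $q$ is $[t_q,\min\{t\ge t_q:\hat e_q^t=0\})$. Levels. For $q$ with $\hat e_q>0$ let $j_q=\min\{j:\hat e_{q,j}=0\}$. For $i\le j_q$ with $\tau_i\ge t_q$, a queue $q'$ storing LQD packets at $\tau_i$ is live w.r.t. $q$ if $\tau_i<t_{q'}$, or if $e_{q'}=0$ and $s^{\tau_{j_q}}_{\mathrm{LQD}}(q')\ge1$. $\sigma_{q,i}$ is the average of $s^{\tau_i}_{\mathrm{LQD}}(q')$ over queues live w.r.t. $q$ at $\tau_i$ ($1$ if there are none). Running-max envelope. $a_{i_q}=\lceil\sigma_{q,i_q}\rceil-1$, $a_i=\max\{\sigma_{q,i}-1,a_{i-1}\}$ for $i_q<i\le j_q$; $b_j=a_{i(t_q+j)}$ where $i(t)$ is the phase containing step $t$ (extended constantly after the last level). Splitting scheme with parameters $\alpha,\beta$. $o_{q,i}$ is the number of packets LQD transmits from $q$ in phase $i$; $o_i$ is the sum of $o_{q',i}$ over queues with $t_{q'}\le\tau_i$ and $e_{q'}>0$; $n_i$ is the analogous sum over all other queues. $\Psi_i=\alpha|\mathcal A_i|$, $\mathcal A_i$ being the set of queues nonempty at $\tau_i$ in LQD's or OPT's buffer with $t_q>\tau_i$; $\Delta_i\Psi=\Psi_{i+1}-\Psi_i$. $\hat e_{\bullet,i}=\sum_{q':t_{q'}\le\tau_i}\hat e_{q',i}$. Each $q$ with $t_q\le\tau_i$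 and $\hat e_{q,i}>0$ receives in phase $i$ the payment $$\Delta_iP_q=\Bigl[\tfrac{\hat e_{q,i}}{\hat e_{\bullet,i}}(n_i+\alpha o_i-\Delta_i\Psi)+\beta o_{q,i}\Bigr]+(1-\alpha-\beta)o_{q,i},$$ the bracket being the L-increase and the last term the S-increase. $\mathrm{payment}_q$ is the sum of these payments over all such phases. Imported per-phase facts (from earlier work on the payment scheme, with its mapping $m_q$). For every $q$ with $\hat e_q>0$ and every phase $i$ with $\tau_i\ge t_q$, $\hat e_{q,i}>0$: $\sigma_{q,i}\ge2$; if $\sigma_{q,i+1}\ge\sigma_{q,i}$ the L-increase in phase $i$ is at least $$\sum_{t=\tau_i}^{\tau_{i+1}-1}\frac{\hat e_q^t}{\sigma_{q,i}-1}+\alpha\hat e_q^{\tau_{i+1}-1}\frac{\sigma_{q,i+1}-\sigma_{q,i}}{\sigma_{q,i}-1};$$ if $\sigma_{q,i+1}<\sigma_{q,i}$ (and $\beta\ge1-\sqrt{1-\alpha}-\alpha/2$) it is at least $$\sum_{t=\tau_i}^{\tau_{i+1}-1}\frac{\hat e_q^t}{\sigma_{q,i}-1}-\frac{g_{q,i}}{2(\sigma_{q,i}-1)}-\hat e_{q,i+1}\Bigl(\frac1{\sigma_{q,i+1}-1}-\frac1{\sigma_{q,i}-1}\Bigr),$$ where $g_{q,i}$ is the number of steps $t$ in phase $i$ with $\hat e_q^t>0$ and $s^t_{\mathrm{LQD}}(q)=0$, and the last term is void if $\hat e_{q,i+1}=0$. *)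

theory Defs
  imports "HOL-Analysis.Analysis"
begin

section \<open>Shared-memory switch\<close>

text \<open>The queues are the elements of a finite type \<^typ>\<open>'q\<close>; steps are natural numbers. A schedule
  \<^term>\<open>s\<close> gives the queue sizes \<^term>\<open>s t q\<close> after the arrivals and evictions of step \<^term>\<open>t\<close> and
  before its transmissions. Packets of one queue are interchangeable, so these sizes determine
  everything a policy does.\<close>

definition pre_size :: "(nat \<Rightarrow> 'q \<Rightarrow> nat) \<Rightarrow> (nat \<Rightarrow> 'q \<Rightarrow> nat) \<Rightarrow> nat \<Rightarrow> 'q \<Rightarrow> nat" where
  "pre_size arr s t q = (case t of 0 \<Rightarrow> 0 | Suc t' \<Rightarrow> s t' q - 1) + arr t q"

definition feasible :: "nat \<Rightarrow> (nat \<Rightarrow> 'q::finite \<Rightarrow> nat) \<Rightarrow> (nat \<Rightarrow> 'q \<Rightarrow> nat) \<Rightarrow> bool" where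
  "feasible B arr s \<longleftrightarrow> (\<forall>t. (\<forall>q. s t q \<le> pre_size arr s t q) \<and> (\<Sum>q\<in>UNIV. s t q) \<le> B)"

text \<open>Every nonempty queue transmits one packet per step. For finitely many arrivals the following
  set is finite for every feasible schedule.\<close>

definition throughput :: "(nat \<Rightarrow> 'q \<Rightarrow> nat) \<Rightarrow> nat" where
  "throughput s = card {(t, q). s t q > 0}"

definition optimal :: "nat \<Rightarrow> (nat \<Rightarrow> 'q::finite \<Rightarrow> nat) \<Rightarrow> (nat \<Rightarrow> 'q \<Rightarrow> nat) \<Rightarrow> bool" where
  "optimal B arr s \<longleftrightarrow> feasible B arr s \<and> (\<forall>s'. feasible B arr s' \<longrightarrow> throughput s' \<le> throughput s)"

text \<open>Being a relation, this allows every tie rule.\<close>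

inductive lqd_evict :: "nat \<Rightarrow> ('q::finite \<Rightarrow> nat) \<Rightarrow> ('q \<Rightarrow> nat) \<Rightarrow> bool" for B where
  fits: "(\<Sum>q\<in>UNIV. x q) \<le> B \<Longrightarrow> lqd_evict B x x"
| evict: "(\<Sum>q\<in>UNIV. x q) > B \<Longrightarrow> \<forall>q'. x q' \<le> x q \<Longrightarrow> lqd_evict B (x(q := x q - 1)) y \<Longrightarrow>
    lqd_evict B x y"

definition lqd_schedule :: "nat \<Rightarrow> (nat \<Rightarrow> 'q::finite \<Rightarrow> nat) \<Rightarrow> (nat \<Rightarrow> 'q \<Rightarrow> nat) \<Rightarrow> bool" where
  "lqd_schedule B arr s \<longleftrightarrow> (\<forall>t. lqd_evict B (pre_size arr s t) (s t))"


section \<open>LQD and OPT side by side\<close>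

text \<open>The field \<open>mapped\<close> holds the numbers $m_q$ supplied by the mapping procedure.\<close>

record 'q run =
  bufsize :: nat
  arr :: "nat \<Rightarrow> 'q \<Rightarrow> nat"
  lqd :: "nat \<Rightarrow> 'q \<Rightarrow> nat"
  opt :: "nat \<Rightarrow> 'q \<Rightarrow> nat"
  mapped :: "'q \<Rightarrow> nat"

definition valid_run :: "'q::finite run \<Rightarrow> bool" where
  "valid_run R \<longleftrightarrow> finite {(t, q). arr R t q > 0} \<and>
     lqd_schedule (bufsize R) (arr R) (lqd R) \<and> optimal (bufsize R) (arr R) (opt R)"

definition A1 :: "'q run \<Rightarrow> bool" where
  "A1 R \<longleftrightarrow> (\<forall>t q. lqd R t q \<le> 1 \<and> (\<exists>t'\<le>t. arr R t' q > 0) \<longrightarrow> (\<forall>t'>t. arr R t' q = 0))"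

definition s_max :: "'q::finite run \<Rightarrow> nat \<Rightarrow> nat" where
  "s_max R t = Max (range (lqd R t))"


subsection \<open>Debts\<close>

definition e_from :: "'q run \<Rightarrow> 'q \<Rightarrow> nat \<Rightarrow> nat" where
  "e_from R q t = card {t'. t \<le> t' \<and> opt R t' q > 0 \<and> lqd R t' q = 0}"

definition e_total :: "'q run \<Rightarrow> 'q \<Rightarrow> nat" where
  "e_total R q = card {t. opt R t q > 0 \<and> lqd R t q = 0}"

definition lqd_extra :: "'q run \<Rightarrow> nat" where
  "lqd_extra R = card {(t, q). lqd R t q > 0 \<and> opt R t q = 0}"

definition valid_mapping :: "'q::finite run \<Rightarrow> bool" where
  "valid_mapping R \<longleftrightarrow>
     (\<forall>q. mapped R q \<le> e_total R q) \<and> (\<Sum>q\<in>UNIV. mapped R q) \<le> lqd_extra R"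

definition hat_e :: "'q run \<Rightarrow> 'q \<Rightarrow> nat" where
  "hat_e R q = e_total R q - mapped R q"

text \<open>The truncated subtraction is $\max\{e_q^t - m_q, 0\}$.\<close>

definition hat_e_from :: "'q run \<Rightarrow> 'q \<Rightarrow> nat \<Rightarrow> nat" where
  "hat_e_from R q t = e_from R q t - mapped R q"


subsection \<open>Phases\<close>

text \<open>LQD evicts (or rejects) a packet of \<^term>\<open>q\<close> in step \<^term>\<open>t\<close> iff the size of \<^term>\<open>q\<close> drops
  below its size right after the arrivals.\<close>

definition overflows :: "'q::finite run \<Rightarrow> nat \<Rightarrow> 'q \<Rightarrow> bool" where
  "overflows R t q \<longleftrightarrow>
     lqd R t q < pre_size (arr R) (lqd R) t q \<or>
     ((\<Sum>q'\<in>UNIV. lqd R t q') = bufsize R \<and> lqd R t q \<ge> max (s_max R t - 1) 1)"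

definition key_step :: "'q::finite run \<Rightarrow> 'q \<Rightarrow> int" where
  "key_step R q = (if \<exists>t. overflows R t q then int (Max {t. overflows R t q}) else -1)"

definition key_steps :: "'q::finite run \<Rightarrow> nat set" where
  "key_steps R = {t. \<exists>q. key_step R q = int t}"

definition num_phases :: "'q::finite run \<Rightarrow> nat" where
  "num_phases R = card (key_steps R)"

definition last_active :: "'q run \<Rightarrow> nat" where
  "last_active R = Max {t. \<exists>q. arr R t q > 0 \<or> lqd R t q > 0 \<or> opt R t q > 0}"

text \<open>Phases are numbered from 1 to \<^term>\<open>num_phases R\<close>; index 0 of \<open>tau\<close> is not used.\<close>

definition tau :: "'q::finite run \<Rightarrow> nat \<Rightarrow> nat" where
  "tau R i = (if i \<le> num_phases R then sorted_list_of_set (key_steps R) ! (i - 1)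
              else last_active R + 1)"

text \<open>The phase containing step \<^term>\<open>t\<close>. Steps after the last active step get index
  \<^term>\<open>num_phases R + 1\<close>.\<close>

definition phase_of :: "'q::finite run \<Rightarrow> nat \<Rightarrow> nat" where
  "phase_of R t = Max {i \<in> {1..num_phases R + 1}. tau R i \<le> t}"

definition phase_steps :: "'q::finite run \<Rightarrow> nat \<Rightarrow> nat set" where
  "phase_steps R i = {tau R i..<tau R (i + 1)}"

definition key_phase :: "'q::finite run \<Rightarrow> 'q \<Rightarrow> nat" where
  "key_phase R q = phase_of R (nat (key_step R q))"


subsection \<open>Levels and the running-max envelope\<close>

definition last_level :: "'q::finite run \<Rightarrow> 'q \<Rightarrow> nat" where
  "last_level R q = (LEAST j. 1 \<le> j \<and> hat_e_from R q (tau R j) = 0)"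

definition live :: "'q::finite run \<Rightarrow> 'q \<Rightarrow> nat \<Rightarrow> 'q set" where
  "live R q i = {q'. lqd R (tau R i) q' \<ge> 1 \<and>
     (int (tau R i) < key_step R q' \<or>
      (e_total R q' = 0 \<and> lqd R (tau R (last_level R q)) q' \<ge> 1))}"

definition sigma :: "'q::finite run \<Rightarrow> 'q \<Rightarrow> nat \<Rightarrow> real" where
  "sigma R q i = (if live R q i = {} then 1
     else (\<Sum>q'\<in>live R q i. real (lqd R (tau R i) q')) / real (card (live R q i)))"

text \<open>\<open>env_level R q k\<close> is $a_i$ for $i = i_q + k$.\<close>

primrec env_level :: "'q::finite run \<Rightarrow> 'q \<Rightarrow> nat \<Rightarrow> real" where
  "env_level R q 0 = of_int \<lceil>sigma R q (key_phase R q)\<rceil> - 1"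
| "env_level R q (Suc k) = max (sigma R q (key_phase R q + Suc k) - 1) (env_level R q k)"

text \<open>$b_j = a_{i(t_q+j)}$. The minimum extends the levels constantly after the last one.\<close>

definition envelope :: "'q::finite run \<Rightarrow> 'q \<Rightarrow> nat \<Rightarrow> real" where
  "envelope R q j = env_level R q
     (min (phase_of R (nat (key_step R q) + j)) (last_level R q) - key_phase R q)"

definition b_init :: "'q::finite run \<Rightarrow> 'q \<Rightarrow> nat" where
  "b_init R q = nat (\<lceil>sigma R q (key_phase R q)\<rceil> - 1)"


section \<open>Splitting scheme\<close>

definition transmitted :: "'q::finite run \<Rightarrow> 'q \<Rightarrow> nat \<Rightarrow> nat" where
  "transmitted R q i = card {t \<in> phase_steps R i. lqd R t q > 0}"

definition old_queues :: "'q::finite run \<Rightarrow> nat \<Rightarrow> 'q set" where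
  "old_queues R i = {q. key_step R q \<le> int (tau R i) \<and> e_total R q > 0}"

definition o_sum :: "'q::finite run \<Rightarrow> nat \<Rightarrow> nat" where
  "o_sum R i = (\<Sum>q\<in>old_queues R i. transmitted R q i)"

definition n_sum :: "'q::finite run \<Rightarrow> nat \<Rightarrow> nat" where
  "n_sum R i = (\<Sum>q\<in>- old_queues R i. transmitted R q i)"

definition Psi :: "'q::finite run \<Rightarrow> real \<Rightarrow> nat \<Rightarrow> real" where
  "Psi R \<alpha> i = \<alpha> * real (card {q. (lqd R (tau R i) q > 0 \<or> opt R (tau R i) q > 0) \<and>
                                 key_step R q > int (tau R i)})"

definition hat_e_sum :: "'q::finite run \<Rightarrow> nat \<Rightarrow> nat" where
  "hat_e_sum R i = (\<Sum>q | key_step R q \<le> int (tau R i). hat_e_from R q (tau R i))"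

definition L_increase :: "'q::finite run \<Rightarrow> real \<Rightarrow> real \<Rightarrow> 'q \<Rightarrow> nat \<Rightarrow> real" where
  "L_increase R \<alpha> \<beta> q i =
     real (hat_e_from R q (tau R i)) / real (hat_e_sum R i) *
       (real (n_sum R i) + \<alpha> * real (o_sum R i) - (Psi R \<alpha> (i + 1) - Psi R \<alpha> i)) +
     \<beta> * real (transmitted R q i)"

definition S_increase :: "'q::finite run \<Rightarrow> real \<Rightarrow> real \<Rightarrow> 'q \<Rightarrow> nat \<Rightarrow> real" where
  "S_increase R \<alpha> \<beta> q i = (1 - \<alpha> - \<beta>) * real (transmitted R q i)"

definition paid_phases :: "'q::finite run \<Rightarrow> 'q \<Rightarrow> nat set" where
  "paid_phases R q = {i \<in> {1..num_phases R}.
     key_step R q \<le> int (tau R i) \<and> hat_e_from R q (tau R i) > 0}"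

definition payment :: "'q::finite run \<Rightarrow> real \<Rightarrow> real \<Rightarrow> 'q \<Rightarrow> real" where
  "payment R \<alpha> \<beta> q = (\<Sum>i\<in>paid_phases R q. L_increase R \<alpha> \<beta> q i + S_increase R \<alpha> \<beta> q i)"


subsection \<open>Per-phase facts from the earlier payment scheme\<close>

definition g_steps :: "'q::finite run \<Rightarrow> 'q \<Rightarrow> nat \<Rightarrow> nat" where
  "g_steps R q i = card {t \<in> phase_steps R i. hat_e_from R q t > 0 \<and> lqd R t q = 0}"

definition per_phase_facts :: "'q::finite run \<Rightarrow> real \<Rightarrow> real \<Rightarrow> bool" where
  "per_phase_facts R \<alpha> \<beta> \<longleftrightarrow> (\<forall>q. hat_e R q > 0 \<longrightarrow> (\<forall>i\<in>paid_phases R q.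
     sigma R q i \<ge> 2 \<and>
     (sigma R q (i + 1) \<ge> sigma R q i \<longrightarrow>
        L_increase R \<alpha> \<beta> q i \<ge>
          (\<Sum>t\<in>phase_steps R i. real (hat_e_from R q t) / (sigma R q i - 1)) +
          \<alpha> * real (hat_e_from R q (tau R (i + 1) - 1)) *
            ((sigma R q (i + 1) - sigma R q i) / (sigma R q i - 1))) \<and>
     (sigma R q (i + 1) < sigma R q i \<and> \<beta> \<ge> 1 - sqrt (1 - \<alpha>) - \<alpha> / 2 \<longrightarrow>
        L_increase R \<alpha> \<beta> q i \<ge>
          (\<Sum>t\<in>phase_steps R i. real (hat_e_from R q t) / (sigma R q i - 1)) -
          real (g_steps R q i) / (2 * (sigma R q i - 1)) -
          (if hat_e_from R q (tau R (i + 1)) = 0 then 0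
           else real (hat_e_from R q (tau R (i + 1))) *
             (1 / (sigma R q (i + 1) - 1) - 1 / (sigma R q i - 1))))))"


section \<open>The lower-bound functional\<close>

text \<open>$D(b_0,\dots,b_m)$ for \<open>k\<close> $= b_0$ and \<open>e\<close> $= \hat e_q$, so that $m =$ \<open>k + e\<close>; only the
  values of \<open>b\<close> on \<open>{0..k + e}\<close> matter.\<close>

definition D :: "real \<Rightarrow> nat \<Rightarrow> nat \<Rightarrow> (nat \<Rightarrow> real) \<Rightarrow> real" where
  "D \<alpha> k e b =
     (\<Sum>j = 0..<k. (\<alpha> * (b (j + 1) - b j) + 1) / b j * real e) +
     (\<Sum>j = k..<k + e. (\<alpha> * (b (j + 1) - b j) + 1) / b j * (real e + real k - real j)
                        - 1 / (2 * b j))"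

definition monotone_seqs :: "nat \<Rightarrow> nat \<Rightarrow> (nat \<Rightarrow> real) set" where
  "monotone_seqs k m = {b. b 0 = real k \<and> mono_on {0..m} b}"

end

theory Submission
  imports Defs
begin

text \<open>After its key step LQD accepts everything sent to \<^term>\<open>q\<close>, so by A1 its debt stays at $\hat e_q$ for
  the \<open>K\<close> steps in which LQD keeps \<^term>\<open>q\<close> nonempty and then drops by one in each of $\hat e_q$ steps.
  At the key step \<^term>\<open>q\<close> is within one packet of the longest queue, hence \<open>K\<close> $\ge b_0$; the S-increases
  pay for these steps, and delaying the repayment from $b_0$ to \<open>K\<close> only increases the functional.
  Writing $c_i = \sigma_{q,i} - 1$ and $a_i$ for its running maximum, the L-increases up to phase $i$
  fall short of the envelope's share by at most $\hat e_{q,i}(1/c_i - 1/a_i)$: entering a dip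
  costs this amount, the first step of the next phase earns it back at the higher rate $1/c_i$, and
  climbing below the running maximum costs nothing. Only the last phase, where no debt
  remains, leaves a deficit of $1/2$.\<close>

section \<open>Schedules and evictions\<close>

lemma pre_size_Suc: "pre_size a s (Suc t) q = s t q - 1 + a (Suc t) q"
  by (simp add: pre_size_def)

text \<open>A packet in the queue has either just arrived or was stored one step earlier. This
  supplies the premise of A1 that the queue has received a packet.\<close>

lemma pre_size_pos_imp_arrival:
  assumes "\<And>t. s t q \<le> pre_size a s t q" and "pre_size a s t q > 0"
  shows "\<exists>t'\<le>t. a t' q > 0"
  using assms(2)
proof (induction t)
  case 0
  then show ?case by (auto simp: pre_size_def)
next
  case (Suc t)
  show ?case
  proof (cases "a (Suc t) q > 0")
    case False
    then have "s t q > 0" using Suc.prems by (simp add: pre_size_Suc)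
    then have "pre_size a s t q > 0" using assms(1)[of t] by linarith
    then show ?thesis using Suc.IH le_SucI by blast
  qed auto
qed

text \<open>Without arrivals each step costs a nonempty queue its transmitted packet, and evictions
  only lower the size further; so the bound serves LQD and OPT alike.\<close>

lemma size_after_arrivals:
  assumes "\<And>t. s t q \<le> pre_size a s t q" and "\<And>t. t > t0 \<Longrightarrow> a t q = 0"
  shows "s (t0 + n) q \<le> s t0 q - n"
proof (induction n)
  case (Suc n)
  have "s (t0 + Suc n) q \<le> s (t0 + n) q - 1"
    using assms(1)[of "t0 + Suc n"] assms(2)[of "t0 + Suc n"] by (simp add: pre_size_Suc)
  with Suc show ?case by linarith
qed simp

text \<open>After a bound \<open>T\<close> on all arrivals, a queue is empty after as many steps as
  it held packets. Finiteness makes the \<open>Max\<close> in \<open>last_active\<close> and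
  \<open>key_step\<close> an actual maximum.\<close>

lemma finite_nonempty_steps:
  fixes s :: "nat \<Rightarrow> 'q::finite \<Rightarrow> nat"
  assumes le: "\<And>t q. s t q \<le> pre_size a s t q" and fin: "finite {(t, q). a t q > 0}"
  shows "finite {t. \<exists>q. a t q > 0 \<or> s t q > 0}"
proof -
  obtain T where T: "\<And>t q. a t q > 0 \<Longrightarrow> t \<le> T"
  proof -
    have "finite (fst ` {(t, q). a t q > 0})" using fin by simp
    then obtain T where "\<forall>t\<in>fst ` {(t, q). a t q > 0}. t \<le> T"
      using finite_nat_set_iff_bounded_le by blast
    then have "t \<le> T" if "a t q > 0" for t q
      using that by (metis (mono_tags) case_prodI fst_conv image_eqI mem_Collect_eq)
    then show ?thesis by (rule that)
  qed
  have "t \<le> T + (\<Sum>q\<in>UNIV. s T q)" if "a t q > 0 \<or> s t q > 0" for t q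
  proof (rule ccontr)
    assume *: "\<not> ?thesis"
    then have "T \<le> t" by simp
    then obtain n where n: "t = T + n" by (rule le_Suc_ex[THEN exE])
    have "s T q \<le> (\<Sum>q\<in>UNIV. s T q)" by (rule member_le_sum) auto
    moreover have "s (T + n) q \<le> s T q - n"
    proof (rule size_after_arrivals)
      show "a t q = 0" if "t > T" for t using T[of t q] that by (cases "a t q") auto
    qed (rule le)
    moreover have "a t q = 0" using T[of t q] * by (cases "a t q") auto
    ultimately show False using that * n by auto
  qed
  then have "{t. \<exists>q. a t q > 0 \<or> s t q > 0} \<subseteq> {..T + (\<Sum>q\<in>UNIV. s T q)}" by auto
  then show ?thesis using finite_subset by blast
qed

lemma lqd_evict_le: "lqd_evict B x y \<Longrightarrow> y q \<le> x q"
proof (induction rule: lqd_evict.induct)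
  case (evict x p y)
  then show ?case by (auto split: if_splits)
qed simp

lemma lqd_evict_fits: "lqd_evict B x y \<Longrightarrow> (\<Sum>q\<in>UNIV. x q) \<le> B \<Longrightarrow> y = x"
  by (cases rule: lqd_evict.cases) auto

lemma lqd_evict_sum_le: "lqd_evict B x y \<Longrightarrow> (\<Sum>q\<in>UNIV. y q) \<le> B"
  by (induction rule: lqd_evict.induct) auto

text \<open>At the last eviction from \<open>q\<close> this queue is a longest one and shrinks by
  one; later evictions hit other queues only and shorten them.\<close>

lemma lqd_evict_victim_longest:
  "lqd_evict B x y \<Longrightarrow> y q < x q \<Longrightarrow> y q' \<le> y q + 1"
proof (induction rule: lqd_evict.induct)
  case (evict x p y)
  show ?case
  proof (cases "y q < (x(p := x p - 1)) q")
    case False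
    with evict.prems have q: "q = p" "y q = x q - 1"
      using lqd_evict_le[OF evict.hyps(3), of q] by (auto split: if_splits)
    have "y q' \<le> x q'"
      using lqd_evict_le[OF evict.hyps(3), of q'] by (auto split: if_splits)
    moreover have "x q' \<le> x p" using evict.hyps(2) by blast
    ultimately show ?thesis using q by simp
  qed (use evict.IH in blast)
qed simp
section \<open>The running maximum\<close>

text \<open>Induction on \<open>i\<close>: the payments stay at most the potential
  \<open>?\<Phi>\<close> below the envelope's share. The level \<open>c j1\<close> has no lower
  bound, but no debt is left there, so a constant takes the place of the potential.\<close>

lemma running_max_potential:
  fixes tau E :: "nat \<Rightarrow> nat" and g :: "nat \<Rightarrow> bool" and c a L :: "nat \<Rightarrow> real" and \<alpha> :: real
  defines "W i \<equiv> {tau i..<tau (Suc i)}"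
  assumes tau: "\<And>i. \<lbrakk>i0 \<le> i; i < j1\<rbrakk> \<Longrightarrow> tau i < tau (Suc i)"
    and a_init: "c i0 \<le> a i0"
    and a_Suc: "\<And>i. \<lbrakk>i0 \<le> i; i < j1\<rbrakk> \<Longrightarrow> a (Suc i) = max (c (Suc i)) (a i)"
    and c_ge: "\<And>i. \<lbrakk>i0 \<le> i; i < j1\<rbrakk> \<Longrightarrow> 1 \<le> c i"
    and E_pos: "\<And>i. \<lbrakk>i0 \<le> i; i < j1\<rbrakk> \<Longrightarrow> E (tau i) > 0"
    and E_end: "E (tau j1) = 0"
    and g_pos: "\<And>t. g t \<Longrightarrow> E t > 0"
    and "\<alpha> \<ge> 0"
    and up: "\<And>i. \<lbrakk>i0 \<le> i; i < j1; c i \<le> c (Suc i)\<rbrakk> \<Longrightarrow>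
      L i \<ge> (\<Sum>t\<in>W i. real (E t) / c i) + \<alpha> * real (E (tau (Suc i) - 1)) * ((c (Suc i) - c i) / c i)"
    and down: "\<And>i. \<lbrakk>i0 \<le> i; i < j1; c (Suc i) < c i\<rbrakk> \<Longrightarrow>
      L i \<ge> (\<Sum>t\<in>W i. real (E t) / c i) - real (card {t \<in> W i. g t}) / (2 * c i) -
        (if E (tau (Suc i)) = 0 then 0 else real (E (tau (Suc i))) * (1 / c (Suc i) - 1 / c i))"
    and i: "i0 \<le> i" "i \<le> j1"
  shows "(\<Sum>k=i0..<i. L k) \<ge>
    (\<Sum>k=i0..<i. (\<Sum>t\<in>W k. real (E t) / a k) - real (card {t \<in> W k. g t}) / (2 * a k) +
       \<alpha> * real (E (tau (Suc k) - 1)) * ((a (Suc k) - a k) / a k)) -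
    (if i = j1 then 1/2 else real (E (tau i)) * (1 / c i - 1 / a i))"
    (is "_ \<ge> (\<Sum>k=i0..<i. ?P k) - ?\<Phi> i")
  using i
proof (induction i rule: dec_induct)
  case base
  show ?case
  proof (cases "i0 = j1")
    case False
    then have "1 \<le> c i0" using c_ge[of i0] order_trans[OF i] by simp
    then show ?thesis using False a_init by (auto intro!: divide_left_mono mult_nonneg_nonneg)
  qed simp
next
  case (step i)
  then have r: "i0 \<le> i" "i < j1" by auto
  have c_le_a: "c i \<le> a i"
    using r a_init a_Suc[of "i - 1"] by (cases "i = i0") auto
  define x y where "x = 1 / c i" and "y = 1 / a i"
  define S where "S = (\<Sum>t\<in>W i. real (E t))"
  define G where "G = real (card {t \<in> W i. g t})"
  define F where "F = real (E (tau (Suc i) - 1))"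
  have c1: "c i \<ge> 1" and a1: "a i \<ge> 1" using c_ge[OF r] c_le_a by auto
  have y: "0 \<le> y" and xy: "y \<le> x" and x1: "x \<le> 1"
    using c1 a1 c_le_a by (auto simp: x_def y_def intro: divide_left_mono)
  have first: "tau i \<in> W i" and finW: "finite (W i)" using tau[OF r] by (auto simp: W_def)
  have S_split: "S = real (E (tau i)) + (\<Sum>t\<in>W i - {tau i}. real (E t))"
    unfolding S_def by (rule sum.remove[OF finW first])
  then have S_ge: "S \<ge> real (E (tau i))" by (simp add: sum_nonneg)
  \<comment> \<open>The first step of the phase is spent on the potential; it is the only debt-reducing step
    whose loss $1/(2c_i)$ is not covered by its own debt.\<close>
  have S_ge_G: "S - real (E (tau i)) \<ge> G - 1"
  proof -
    have "G = (\<Sum>t\<in>W i. of_bool (g t))" by (simp add: G_def finW Int_def)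
    also have "\<dots> = of_bool (g (tau i)) + (\<Sum>t\<in>W i - {tau i}. of_bool (g t))"
      by (rule sum.remove[OF finW first])
    also have "\<dots> \<le> 1 + (\<Sum>t\<in>W i - {tau i}. real (E t))"
      using g_pos by (intro add_mono sum_mono) (auto simp: of_bool_def Suc_le_eq)
    finally show ?thesis using S_split by simp
  qed
  have S_sum: "(\<Sum>t\<in>W i. real (E t) / z) = S / z" for z by (simp add: S_def sum_divide_distrib)
  have P: "?P i = S * y - G * y / 2 + \<alpha> * F * ((a (Suc i) - a i) / a i)"
    by (simp add: S_sum y_def G_def F_def)
  have IH: "(\<Sum>k=i0..<i. L k) \<ge> (\<Sum>k=i0..<i. ?P k) - real (E (tau i)) * (x - y)"
    using step.IH r by (simp add: x_def y_def)
  have F0: "0 \<le> \<alpha> * F" using \<open>\<alpha> \<ge> 0\<close> by (simp add: F_def)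
  have SE: "S * (x - y) \<ge> real (E (tau i)) * (x - y)"
    using S_ge xy by (intro mult_right_mono) auto
  have G0: "0 \<le> G" "0 \<le> G * y" using y by (auto simp: G_def)
  have "L i - ?P i \<ge> real (E (tau i)) * (x - y) - ?\<Phi> (Suc i)"
  proof (cases "c i \<le> c (Suc i)")
    case True
    then have L: "L i \<ge> S * x + \<alpha> * F * ((c (Suc i) - c i) / c i)"
      using up[OF r] by (simp add: S_sum x_def F_def)
    \<comment> \<open>A rise of \<open>c\<close> below the running maximum leaves \<open>a\<close>
      unchanged; a rise above it is measured relative to \<open>a i\<close>, which is at least
      \<open>c i\<close>.\<close>
    have jump: "(a (Suc i) - a i) / a i \<le> (c (Suc i) - c i) / c i"
    proof (cases "c (Suc i) \<le> a i")
      case True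
      then show ?thesis using a_Suc[OF r] \<open>c i \<le> c (Suc i)\<close> c1 by (simp add: max_def)
    next
      case False
      then have "c (Suc i) / a i \<le> c (Suc i) / c i" using c1 a1 c_le_a by (intro divide_left_mono) auto
      then show ?thesis using False a_Suc[OF r] c1 a1 by (simp add: max_def diff_divide_distrib)
    qed
    have \<Phi>: "?\<Phi> (Suc i) \<ge> 0"
    proof (cases "Suc i = j1")
      case False
      then have "1 \<le> c (Suc i)" "c (Suc i) \<le> a (Suc i)" using c_ge[of "Suc i"] a_Suc[OF r] r by auto
      then show ?thesis using False by (auto intro!: mult_nonneg_nonneg divide_left_mono)
    qed simp
    show ?thesis using L P SE G0 \<Phi> mult_left_mono[OF jump F0] by (simp add: algebra_simps)
  next
    case False
    then have a': "a (Suc i) = a i" using a_Suc[OF r] c_le_a by simp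
    then have P': "?P i = S * y - G * y / 2" using P by simp
    show ?thesis
    proof (cases "Suc i = j1")
      case True
      then have L: "L i \<ge> S * x - G * x / 2"
        using down[OF r] False E_end by (simp add: S_sum x_def G_def)
      \<comment> \<open>The average of \<open>S_ge\<close> and \<open>S_ge_G\<close> gives the
        factor -1/2. This is the final deficit, as \<open>x - y\<close> is at most 1.\<close>
      have "(S - real (E (tau i)) - G / 2) * (x - y) \<ge> (- 1 / 2) * (x - y)"
        using xy S_ge S_ge_G G0 by (intro mult_right_mono) linarith+
      moreover have "(- 1 / 2) * (x - y) \<ge> - 1 / 2" using x1 y by simp
      ultimately have "(S - real (E (tau i)) - G / 2) * (x - y) \<ge> - 1 / 2"
        by (rule order_trans[rotated])
      then show ?thesis unfolding P' using L True by (simp add: algebra_simps diff_divide_distrib)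
    next
      case False': False
      then have E': "E (tau (Suc i)) \<ge> 1" using E_pos[of "Suc i"] r by simp
      have L: "L i \<ge> S * x - G * x / 2 - real (E (tau (Suc i))) * (1 / c (Suc i) - x)"
        using down[OF r] False E' by (simp add: S_sum x_def G_def)
      \<comment> \<open>The potential charges the remaining debt the rate difference to
        \<open>y\<close>, the penalty only that to \<open>x\<close>. This gains \<open>x - y\<close>
        per packet, and one packet outweighs the -1/2.\<close>
      have "(S - real (E (tau i)) - G / 2 + real (E (tau (Suc i)))) * (x - y) \<ge> 0"
        using xy S_ge S_ge_G G0 E' by (intro mult_nonneg_nonneg) linarith+
      then show ?thesis unfolding P' using L False' a' by (simp add: algebra_simps y_def)
    qed
  qed
  then show ?case using IH r by simp
qed

text \<open>The order of the end points is carried through the induction because joining two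
  intervals needs it.\<close>

lemma sum_concat:
  fixes f :: "nat \<Rightarrow> 'a::comm_monoid_add" and tau :: "nat \<Rightarrow> nat"
  assumes "i0 \<le> i" and "\<And>k. \<lbrakk>i0 \<le> k; k < i\<rbrakk> \<Longrightarrow> tau k \<le> tau (Suc k)"
  shows "tau i0 \<le> tau i \<and> (\<Sum>k=i0..<i. \<Sum>t\<in>{tau k..<tau (Suc k)}. f t) = sum f {tau i0..<tau i}"
  using assms
proof (induction i rule: dec_induct)
  case (step i)
  have *: "tau i0 \<le> tau i" "tau i \<le> tau (Suc i)" using step by auto
  then show ?case using step order_trans[OF *] by (simp add: sum.atLeastLessThan_concat)
qed simp

section \<open>The lower-bound functional\<close>

text \<open>Truncated subtraction merges both ranges: \<open>e - (j - k)\<close> is the debt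
  \<open>j\<close> steps after the key step if repayment starts after \<open>k\<close>
  steps.\<close>

lemma D_eq:
  "D \<alpha> k e b = (\<Sum>j=0..<k+e. (\<alpha> * (b (j + 1) - b j) + 1) / b j * real (e - (j - k)))
     - (\<Sum>j=k..<k+e. 1 / (2 * b j))"
proof -
  have "(\<Sum>j=0..<k. (\<alpha> * (b (j + 1) - b j) + 1) / b j * real e)
      = (\<Sum>j=0..<k. (\<alpha> * (b (j + 1) - b j) + 1) / b j * real (e - (j - k)))"
    by (intro sum.cong) auto
  moreover have "(\<Sum>j=k..<k+e. (\<alpha> * (b (j + 1) - b j) + 1) / b j * (real e + real k - real j))
      = (\<Sum>j=k..<k+e. (\<alpha> * (b (j + 1) - b j) + 1) / b j * real (e - (j - k)))"
    by (intro sum.cong) auto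
  ultimately show ?thesis
    unfolding D_def sum_subtractf
    using sum.atLeastLessThan_concat[of 0 k "k + e" "\<lambda>j. (\<alpha> * (b (j + 1) - b j) + 1) / b j * real (e - (j - k))"]
    by simp
qed

text \<open>A later repayment raises every weight of the nonnegative coefficients and moves the
  penalties to later, hence larger, values of \<open>b\<close>.\<close>

lemma D_le_delayed:
  assumes mono: "mono b" and pos: "b 0 > 0" and "0 \<le> \<alpha>" and kK: "k \<le> K" and M: "K + e \<le> M"
  shows "D \<alpha> k e b \<le> (\<Sum>j=0..<M. (\<alpha> * (b (j + 1) - b j) + 1) / b j * real (e - (j - K)))
     - (\<Sum>j=K..<K+e. 1 / (2 * b j))"
proof -
  have bpos: "b j > 0" for j using monoD[OF mono, of 0 j] pos by simp
  have coeff: "(\<alpha> * (b (j + 1) - b j) + 1) / b j \<ge> 0" for j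
    using monoD[OF mono, of j "j + 1"] bpos[of j] \<open>0 \<le> \<alpha>\<close> by simp
  have "(\<Sum>j=0..<k+e. (\<alpha> * (b (j + 1) - b j) + 1) / b j * real (e - (j - k)))
      \<le> (\<Sum>j=0..<k+e. (\<alpha> * (b (j + 1) - b j) + 1) / b j * real (e - (j - K)))"
    using kK by (intro sum_mono mult_left_mono coeff) auto
  also have "\<dots> \<le> (\<Sum>j=0..<M. (\<alpha> * (b (j + 1) - b j) + 1) / b j * real (e - (j - K)))"
    using kK M by (intro sum_mono2 mult_nonneg_nonneg coeff) auto
  finally have 1: "(\<Sum>j=0..<k+e. (\<alpha> * (b (j + 1) - b j) + 1) / b j * real (e - (j - k))) \<le> \<dots>" .
  have "(\<Sum>j=K..<K+e. 1 / (2 * b j)) = (\<Sum>j=k..<k+e. 1 / (2 * b (j + (K - k))))"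
    using sum.shift_bounds_nat_ivl[of "\<lambda>j. 1 / (2 * b j)" k "K - k" "k + e"] kK by (simp add: add.commute)
  also have "\<dots> \<le> (\<Sum>j=k..<k+e. 1 / (2 * b j))"
    using bpos monoD[OF mono] by (intro sum_mono divide_left_mono) auto
  finally show ?thesis unfolding D_eq using 1 by linarith
qed

text \<open>Only the \<open>e\<close> penalties are negative, each at least -1 since
  \<open>b\<close> starts at 1 or above. Over the reals, \<open>INF\<close> is a lower bound only
  for sets bounded below.\<close>

lemma bdd_below_D:
  assumes "k > 0" and "0 \<le> \<alpha>"
  shows "bdd_below (D \<alpha> k e ` monotone_seqs k (k + e))"
proof (rule bdd_belowI2)
  fix b assume "b \<in> monotone_seqs k (k + e)"
  then have b0: "b 0 = real k" and mono: "\<And>i j. i \<le> j \<Longrightarrow> j \<le> k + e \<Longrightarrow> b i \<le> b j"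
    by (auto simp: monotone_seqs_def mono_on_def)
  have b1: "b j \<ge> 1" if "j \<le> k + e" for j using mono[of 0 j] that b0 \<open>k > 0\<close> by simp
  have "(\<Sum>j=0..<k+e. (\<alpha> * (b (j + 1) - b j) + 1) / b j * real (e - (j - k))) \<ge> 0"
  proof (intro sum_nonneg mult_nonneg_nonneg)
    fix j assume "j \<in> {0..<k+e}"
    then show "(\<alpha> * (b (j + 1) - b j) + 1) / b j \<ge> 0"
      using b1[of j] mono[of j "j + 1"] \<open>0 \<le> \<alpha>\<close> by (simp add: Suc_le_eq)
  qed auto
  moreover have "(\<Sum>j=k..<k+e. 1 / (2 * b j)) \<le> (\<Sum>j=k..<k+e. 1)"
  proof (rule sum_mono)
    fix j assume "j \<in> {k..<k+e}"
    then show "1 / (2 * b j) \<le> 1" using b1[of j] by simp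
  qed
  ultimately show "- real e \<le> D \<alpha> k e b" unfolding D_eq by simp
qed

section \<open>Debt and phases of an indebted queue\<close>

locale indebted_queue =
  fixes R :: "'q::finite run" and q :: 'q
  assumes valid: "valid_run R" and a1: "A1 R" and debt: "hat_e R q > 0"
begin

definition e where "e = hat_e R q"
text \<open>The conversion \<open>nat\<close> loses nothing: an indebted queue overflows at some
  step, so its key step is not -1.\<close>

definition t0 where "t0 = nat (key_step R q)"
definition i0 where "i0 = key_phase R q"
definition j1 where "j1 = last_level R q"

lemma e_pos: "e > 0" using debt by (simp add: e_def)

lemma lqd_step: "lqd_evict (bufsize R) (pre_size (arr R) (lqd R) t) (lqd R t)"
  using valid by (simp add: valid_run_def lqd_schedule_def)

lemma lqd_le_pre: "lqd R t p \<le> pre_size (arr R) (lqd R) t p"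
  by (rule lqd_evict_le[OF lqd_step])

lemma opt_le_pre: "opt R t p \<le> pre_size (arr R) (opt R) t p"
  using valid by (simp add: valid_run_def optimal_def feasible_def)

section \<open>Finiteness of the active steps\<close>

abbreviation active where "active \<equiv> {t. \<exists>p. arr R t p > 0 \<or> lqd R t p > 0 \<or> opt R t p > 0}"

lemma finite_active: "finite active"
proof -
  have fin: "finite {(t, p). arr R t p > 0}" using valid by (simp add: valid_run_def)
  have "active = {t. \<exists>p. arr R t p > 0 \<or> lqd R t p > 0} \<union> {t. \<exists>p. arr R t p > 0 \<or> opt R t p > 0}"
    by auto
  then show ?thesis
    using finite_nonempty_steps[OF lqd_le_pre fin] finite_nonempty_steps[OF opt_le_pre fin] by simp
qed

lemma active_le: "t \<in> active \<Longrightarrow> t \<le> last_active R"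
  unfolding last_active_def using Max_ge[OF finite_active] by blast

text \<open>In an inactive step LQD's queues are all empty, which excludes the full-buffer
  alternative. Without arrivals the previous content still fits, so nothing is evicted
  either.\<close>

lemma overflow_active: "overflows R t p \<Longrightarrow> t \<in> active"
proof (rule ccontr)
  assume o: "overflows R t p" and "t \<notin> active"
  then have z: "\<And>p. arr R t p = 0" "\<And>p. lqd R t p = 0" by auto
  have "pre_size (arr R) (lqd R) t p > 0" using o z by (auto simp: overflows_def)
  moreover have "lqd R t = pre_size (arr R) (lqd R) t"
  proof (rule lqd_evict_fits[OF lqd_step])
    show "(\<Sum>p\<in>UNIV. pre_size (arr R) (lqd R) t p) \<le> bufsize R"
    proof (cases t)
      case (Suc t')
      have "(\<Sum>p\<in>UNIV. pre_size (arr R) (lqd R) t p) \<le> (\<Sum>p\<in>UNIV. lqd R t' p)"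
        using z Suc by (intro sum_mono) (simp add: pre_size_Suc)
      then show ?thesis using lqd_evict_sum_le[OF lqd_step[of t']] by linarith
    qed (use z in \<open>simp add: pre_size_def\<close>)
  qed
  ultimately show False using z by simp
qed

lemma finite_overflows: "finite {t. overflows R t p}"
  by (rule finite_subset[OF _ finite_active]) (use overflow_active in blast)

lemma key_step_overflows: "key_step R p = int t \<Longrightarrow> overflows R t p"
  using Max_in[OF finite_overflows[of p]] by (auto simp: key_step_def split: if_splits)

lemma finite_key_steps: "finite (key_steps R)"
proof (rule finite_subset[OF _ finite_active], rule subsetI)
  fix t assume "t \<in> key_steps R"
  then show "t \<in> active"
    using overflow_active[OF key_step_overflows] unfolding key_steps_def mem_Collect_eq by (elim exE)
qed

section \<open>The key step of an indebted queue\<close>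

lemma e_total_pos: "e_total R q > 0" using debt by (simp add: hat_e_def)

lemma extra_exists: "\<exists>t. opt R t q > 0 \<and> lqd R t q = 0"
  using e_total_pos unfolding e_total_def card_gt_0_iff by blast

text \<open>If LQD accepted everything sent to \<open>q\<close>, its copy would always be at least
  as long as OPT's, and no packet could be OPT-extra.\<close>

lemma some_overflow: "\<exists>t. overflows R t q"
proof (rule ccontr)
  assume "\<not> ?thesis"
  then have eq: "lqd R t q = pre_size (arr R) (lqd R) t q" for t
    using lqd_le_pre[of t q] by (auto simp: overflows_def not_less intro: antisym)
  have "opt R t q \<le> lqd R t q" for t
  proof (induction t)
    case 0
    then show ?case using opt_le_pre[of 0 q] eq[of 0] by (simp add: pre_size_def)
  next
    case (Suc t)
    then show ?case using opt_le_pre[of "Suc t" q] eq[of "Suc t"] by (simp add: pre_size_Suc)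
  qed
  then show False using extra_exists by (metis leD)
qed

lemma key_step_eq: "key_step R q = int t0"
  using some_overflow by (simp add: t0_def key_step_def)

lemma overflow_t0: "overflows R t0 q"
  using key_step_overflows key_step_eq by blast

lemma no_overflow_after: "t > t0 \<Longrightarrow> \<not> overflows R t q"
  using Max_ge[OF finite_overflows[of q], of t] some_overflow
  by (auto simp: t0_def key_step_def)

lemma lqd_after: "t \<ge> t0 \<Longrightarrow> lqd R (Suc t) q = lqd R t q - 1 + arr R (Suc t) q"
  using no_overflow_after[of "Suc t"] lqd_le_pre[of "Suc t" q]
  by (auto simp: overflows_def pre_size_Suc not_less intro: antisym)

lemma received: "\<exists>t'\<le>t0. arr R t' q > 0"
proof (rule pre_size_pos_imp_arrival[where s = "lqd R"])
  show "pre_size (arr R) (lqd R) t0 q > 0"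
    using overflow_t0 lqd_le_pre[of t0 q] by (auto simp: overflows_def)
qed (rule lqd_le_pre)

text \<open>An eviction from \<open>q\<close> shows it to be within one packet of the longest queue;
  the full-buffer alternative states this outright.\<close>

lemma lqd_t0_ge: "s_max R t0 \<le> lqd R t0 q + 1"
proof -
  consider "lqd R t0 q < pre_size (arr R) (lqd R) t0 q" | "lqd R t0 q \<ge> s_max R t0 - 1"
    using overflow_t0 by (auto simp: overflows_def)
  then show ?thesis
  proof cases
    case 1
    then show ?thesis
      using lqd_evict_victim_longest[OF lqd_step] by (auto simp: s_max_def)
  qed simp
qed

text \<open>If OPT sent an extra packet before \<open>t0\<close>, then \<open>q\<close> would have
  received a packet while LQD's copy is empty. A1 stops all further arrivals, so this copy stays
  empty and cannot overflow at \<open>t0\<close>.\<close>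

lemma extra_after_t0:
  assumes "opt R t q > 0" "lqd R t q = 0"
  shows "t \<ge> t0"
proof (rule ccontr)
  assume "\<not> t \<ge> t0"
  then obtain n where n: "t0 = t + n" "n > 0" by (metis less_imp_add_positive not_le)
  have "\<exists>t'\<le>t. arr R t' q > 0"
    by (rule pre_size_pos_imp_arrival[OF opt_le_pre])
      (rule order_less_le_trans[OF assms(1) opt_le_pre])
  then have z: "\<And>t'. t' > t \<Longrightarrow> arr R t' q = 0" using a1 assms(2) unfolding A1_def
    by (metis zero_le)
  have l: "lqd R (t + k) q = 0" for k
    using size_after_arrivals[of "lqd R" q "arr R" t k] lqd_le_pre z assms(2) by simp
  obtain n' where "n = Suc n'" using n by (cases n) auto
  then have "pre_size (arr R) (lqd R) t0 q = 0"
    using l[of n'] z[of t0] n by (simp add: pre_size_Suc)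
  then show False using overflow_t0 l[of n] n by (simp add: overflows_def)
qed

lemma e_from_le_t0: "t \<le> t0 \<Longrightarrow> e_from R q t = e_total R q"
proof -
  assume "t \<le> t0"
  then have "t \<le> t'" if "opt R t' q > 0" "lqd R t' q = 0" for t'
    using extra_after_t0[OF that] by linarith
  then have "{t'. t \<le> t' \<and> opt R t' q > 0 \<and> lqd R t' q = 0} = {t. opt R t q > 0 \<and> lqd R t q = 0}"
    by blast
  then show "e_from R q t = e_total R q" by (simp add: e_from_def e_total_def)
qed

section \<open>Draining of the queue and its debt curve\<close>

definition K where "K = (LEAST j. lqd R (t0 + j) q = 0)"

lemma K_zero: "lqd R (t0 + K) q = 0"
proof -
  obtain t where "opt R t q > 0" "lqd R t q = 0" using extra_exists by blast
  then have "lqd R (t0 + (t - t0)) q = 0" using extra_after_t0 by simp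
  then show ?thesis unfolding K_def by (rule LeastI)
qed

lemma before_K: "j < K \<Longrightarrow> lqd R (t0 + j) q > 0"
  using not_less_Least unfolding K_def by blast

text \<open>A1 applies at \<open>t0 + K\<close>: LQD's copy is empty there and, by
  \<open>received\<close>, a packet arrived earlier.\<close>

lemma no_arrival_after_K: "t > t0 + K \<Longrightarrow> arr R t q = 0"
proof -
  assume t: "t > t0 + K"
  have "\<exists>t'\<le>t0 + K. arr R t' q > 0" using received trans_le_add1 by blast
  then have "lqd R (t0 + K) q \<le> 1 \<and> (\<exists>t'\<le>t0 + K. arr R t' q > 0)" using K_zero by simp
  then show "arr R t q = 0" using a1 t unfolding A1_def by blast
qed

lemma after_K: "j \<ge> K \<Longrightarrow> lqd R (t0 + j) q = 0"
  using size_after_arrivals[of "lqd R" q "arr R" "t0 + K" "j - K"] lqd_le_pre no_arrival_after_K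
    K_zero by simp

text \<open>After the key step nothing is evicted from \<open>q\<close>, so its size falls by at
  most one per step.\<close>

lemma lqd_t0_le_K: "lqd R t0 q \<le> K"
proof -
  have "lqd R t0 q \<le> lqd R (t0 + j) q + j" for j
  proof (induction j)
    case (Suc j)
    then show ?case using lqd_after[of "t0 + j"] by simp
  qed simp
  from this[of K] show ?thesis using K_zero by simp
qed

text \<open>With arrivals over, OPT's copy stays empty once empty, so its extra transmissions fill
  the \<open>N\<close> steps from \<open>t0 + K\<close> on. \<open>N\<close> is a draining time
  rather than the size at \<open>t0 + K\<close>, since OPT may still evict.\<close>

lemma e_from_after: "e_from R q (t0 + j) = e_total R q - (j - K)"
proof -
  define N where "N = (LEAST n. opt R (t0 + K + n) q = 0)"
  have dec: "opt R (t0 + K + (n + k)) q \<le> opt R (t0 + K + n) q - k" for n k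
    using size_after_arrivals[of "opt R" q "arr R" "t0 + K + n" k] opt_le_pre no_arrival_after_K
    by (simp add: add.assoc)
  have "opt R (t0 + K + (0 + opt R (t0 + K) q)) q = 0" using dec[of 0 "opt R (t0 + K) q"] by simp
  then have N0: "opt R (t0 + K + N) q = 0" unfolding N_def by (metis (mono_tags) LeastI)
  have pos: "opt R (t0 + K + n) q > 0 \<longleftrightarrow> n < N" for n
  proof
    assume "n < N"
    then show "opt R (t0 + K + n) q > 0" using not_less_Least unfolding N_def by blast
  next
    assume *: "opt R (t0 + K + n) q > 0"
    show "n < N"
    proof (rule ccontr)
      assume "\<not> n < N"
      then show False using dec[of N "n - N"] N0 * by simp
    qed
  qed
  have set: "{t'. t0 + j \<le> t' \<and> opt R t' q > 0 \<and> lqd R t' q = 0} = {t0 + max j K..<t0 + K + N}" for j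
  proof (intro set_eqI iffI)
    fix t' assume t': "t' \<in> {t'. t0 + j \<le> t' \<and> opt R t' q > 0 \<and> lqd R t' q = 0}"
    then have "\<not> t' - t0 < K" using before_K[of "t' - t0"] by auto
    then have "t' \<ge> t0 + K" using t' by auto
    then show "t' \<in> {t0 + max j K..<t0 + K + N}" using t' pos[of "t' - (t0 + K)"] by auto
  next
    fix t' assume t': "t' \<in> {t0 + max j K..<t0 + K + N}"
    then show "t' \<in> {t'. t0 + j \<le> t' \<and> opt R t' q > 0 \<and> lqd R t' q = 0}"
      using pos[of "t' - (t0 + K)"] after_K[of "t' - t0"] by auto
  qed
  \<comment> \<open>No extra packet precedes \<open>t0\<close>, so offset 0 counts all of
    them.\<close>
  have "e_total R q = N" using e_from_le_t0[of t0] set[of 0] by (simp add: e_from_def)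
  then show ?thesis using set[of j] by (auto simp: e_from_def max_def)
qed

abbreviation E where "E \<equiv> hat_e_from R q"

lemma E_after: "E (t0 + j) = e - (j - K)"
  by (simp add: hat_e_from_def e_from_after e_def hat_e_def)

lemma E_le_t0: "t \<le> t0 \<Longrightarrow> E t = e"
  by (simp add: hat_e_from_def e_from_le_t0 e_def hat_e_def)

lemma E_pos_iff: "E t > 0 \<longleftrightarrow> t < t0 + K + e"
proof (cases "t \<le> t0")
  case True
  then show ?thesis using E_le_t0 e_pos by simp
next
  case False
  then show ?thesis using E_after[of "t - t0"] e_pos by auto
qed

section \<open>Phases and their numbering\<close>

abbreviation np where "np \<equiv> num_phases R"

lemma tau_key_step: "1 \<le> i \<Longrightarrow> i \<le> np \<Longrightarrow> tau R i \<in> key_steps R"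
  using nth_mem[of "i - 1" "sorted_list_of_set (key_steps R)"] finite_key_steps
  by (simp add: tau_def num_phases_def)

lemma key_step_le_last: "t \<in> key_steps R \<Longrightarrow> t \<le> last_active R"
  unfolding key_steps_def mem_Collect_eq
  by (elim exE) (rule active_le[OF overflow_active[OF key_step_overflows]])

lemma tau_last: "tau R (Suc np) = Suc (last_active R)" by (simp add: tau_def)

lemma tau_less: "1 \<le> i \<Longrightarrow> i < j \<Longrightarrow> j \<le> Suc np \<Longrightarrow> tau R i < tau R j"
proof (cases "j \<le> np")
  case True
  assume "1 \<le> i" "i < j"
  then show ?thesis
    using True sorted_wrt_nth_less[OF strict_sorted_list_of_set, of "i - 1" "j - 1" "key_steps R"]
      finite_key_steps
    by (simp add: tau_def num_phases_def)
next
  case False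
  assume a: "1 \<le> i" "i < j" "j \<le> Suc np"
  then have "j = Suc np" using False by simp
  then show ?thesis using key_step_le_last[OF tau_key_step[of i]] a by (simp add: tau_last)
qed

lemma tau_le: "1 \<le> i \<Longrightarrow> i \<le> j \<Longrightarrow> j \<le> Suc np \<Longrightarrow> tau R i \<le> tau R j"
  using tau_less[of i j] by (cases "i = j") auto

text \<open>Index \<open>Suc np\<close> stands for all steps after the last active one and has no
  upper end, hence the conditional last premise.\<close>

lemma phase_of_eq:
  assumes "1 \<le> i" "i \<le> Suc np" "tau R i \<le> t" "i \<le> np \<Longrightarrow> t < tau R (Suc i)"
  shows "phase_of R t = i"
  unfolding phase_of_def
proof (rule Max_eqI)
  fix y assume y: "y \<in> {i \<in> {1..np + 1}. tau R i \<le> t}"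
  show "y \<le> i"
  proof (rule ccontr)
    assume "\<not> y \<le> i"
    then have "tau R (Suc i) \<le> tau R y" "i \<le> np" using y by (auto intro: tau_le)
    then show False using y assms(4) by simp
  qed
qed (use assms in auto)

lemma i0: "1 \<le> i0" "i0 \<le> np" "tau R i0 = t0"
proof -
  have "t0 \<in> key_steps R" using key_step_eq by (auto simp: key_steps_def)
  then obtain k where k: "k < card (key_steps R)" "sorted_list_of_set (key_steps R) ! k = t0"
    using finite_key_steps by (metis in_set_conv_nth length_sorted_list_of_set set_sorted_list_of_set)
  then have *: "tau R (Suc k) = t0" "Suc k \<le> np" by (auto simp: tau_def num_phases_def)
  have "phase_of R t0 = Suc k" using * tau_less[of "Suc k" "Suc (Suc k)"] by (intro phase_of_eq) auto
  then have "i0 = Suc k" by (simp add: i0_def key_phase_def t0_def)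
  with * show "1 \<le> i0" "i0 \<le> np" "tau R i0 = t0" by auto
qed

text \<open>OPT transmits nothing after the last active step, so \<open>Suc np\<close> witnesses the
  \<open>LEAST\<close> in \<open>last_level\<close>.\<close>

lemma j1: "1 \<le> j1" "E (tau R j1) = 0" "j1 \<le> Suc np"
proof -
  have "opt R t q = 0" if "t \<ge> Suc (last_active R)" for t
  proof -
    have "t \<notin> active" using active_le[of t] that by linarith
    then show ?thesis by auto
  qed
  then have "{t. tau R (Suc np) \<le> t \<and> opt R t q > 0 \<and> lqd R t q = 0} = {}"
    unfolding tau_last by fastforce
  then have "e_from R q (tau R (Suc np)) = 0"
    unfolding e_from_def by (metis card.empty)
  then have *: "1 \<le> Suc np \<and> E (tau R (Suc np)) = 0" by (simp add: hat_e_from_def)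
  show "1 \<le> j1" "E (tau R j1) = 0"
    using LeastI[of "\<lambda>j. 1 \<le> j \<and> E (tau R j) = 0", OF *] by (auto simp: j1_def last_level_def)
  show "j1 \<le> Suc np"
    using Least_le[of "\<lambda>j. 1 \<le> j \<and> E (tau R j) = 0", OF *] by (auto simp: j1_def last_level_def)
qed

lemma E_before_j1: "1 \<le> i \<Longrightarrow> i < j1 \<Longrightarrow> E (tau R i) > 0"
  using not_less_Least[of i "\<lambda>j. 1 \<le> j \<and> E (tau R j) = 0"] by (auto simp: j1_def last_level_def)

lemma i0_less_j1: "i0 < j1"
proof (rule ccontr)
  assume "\<not> i0 < j1"
  then have "tau R j1 \<le> t0" using tau_le[of j1 i0] j1 i0 by auto
  then show False using j1(2) E_pos_iff[of "tau R j1"] e_pos by simp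
qed

lemma tau_j1: "tau R j1 \<ge> t0 + K + e"
  using E_pos_iff[of "tau R j1"] j1(2) by simp

lemma paid: "paid_phases R q = {i0..<j1}"
proof (intro set_eqI iffI)
  fix i assume "i \<in> paid_phases R q"
  then have i: "1 \<le> i" "i \<le> np" "t0 \<le> tau R i" "E (tau R i) > 0"
    by (auto simp: paid_phases_def key_step_eq)
  have "i0 \<le> i" using tau_less[of i i0] i i0 by (cases "i < i0") auto
  moreover have "i < j1"
  proof (rule ccontr)
    assume "\<not> i < j1"
    then have "tau R j1 \<le> tau R i" using tau_le[of j1 i] j1 i by auto
    then show False using i(4) tau_j1 E_pos_iff[of "tau R i"] by simp
  qed
  ultimately show "i \<in> {i0..<j1}" by simp
next
  fix i assume "i \<in> {i0..<j1}"
  then show "i \<in> paid_phases R q"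
    using i0 j1 E_before_j1[of i] tau_le[of i0 i] by (auto simp: paid_phases_def key_step_eq)
qed

end

section \<open>The payment\<close>

locale paid_queue = indebted_queue +
  fixes \<alpha> \<beta> :: real
  assumes alpha: "0 \<le> \<alpha>" and alpha_beta: "\<alpha> + \<beta> \<le> 1"
    and beta: "\<beta> \<ge> 1 - sqrt (1 - \<alpha>) - \<alpha> / 2"
    and facts: "per_phase_facts R \<alpha> \<beta>"
begin

definition c where "c i = sigma R q i - 1"
definition a where "a i = env_level R q (i - i0)"

lemmas phase_fact = facts[unfolded per_phase_facts_def, rule_format, OF debt, unfolded paid]

lemma c_ge: "i0 \<le> i \<Longrightarrow> i < j1 \<Longrightarrow> 1 \<le> c i"
  using phase_fact[of i] by (simp add: c_def)

text \<open>The bound 2 on the first level makes its ceiling minus one positive, so the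
  \<open>nat\<close> in \<open>b_init\<close> truncates nothing.\<close>

lemma a_i0: "a i0 = real (b_init R q)" and b_init_pos: "b_init R q > 0" and c_le_a_i0: "c i0 \<le> a i0"
proof -
  have "sigma R q i0 \<ge> 2" using c_ge[of i0] i0_less_j1 by (simp add: c_def)
  then have *: "\<lceil>sigma R q i0\<rceil> \<ge> 2" by linarith
  have a: "a i0 = of_int \<lceil>sigma R q i0\<rceil> - 1" by (simp add: a_def i0_def)
  show "c i0 \<le> a i0" unfolding a c_def by linarith
  show "b_init R q > 0" using * by (simp add: b_init_def i0_def)
  show "a i0 = real (b_init R q)" unfolding a using * by (simp add: b_init_def i0_def)
qed

lemma a_Suc: "i0 \<le> i \<Longrightarrow> a (Suc i) = max (c (Suc i)) (a i)"
  by (simp add: a_def c_def Suc_diff_le i0_def[symmetric])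

section \<open>The envelope as a function of the step\<close>

lemma mono_env_level: "mono (env_level R q)"
  by (rule incseq_SucI) simp

lemma envelope_eq: "envelope R q j = a (min (phase_of R (t0 + j)) j1)"
  by (simp add: envelope_def a_def i0_def j1_def t0_def)

lemma mono_envelope: "mono (envelope R q)"
proof (rule monoI)
  fix i j :: nat assume "i \<le> j"
  \<comment> \<open>The index \<open>i0\<close> shows that the smaller set is nonempty, as
    \<open>Max_mono\<close> requires.\<close>
  moreover have "i0 \<in> {k \<in> {1..np + 1}. tau R k \<le> t0 + i}" using i0 by simp
  ultimately have "phase_of R (t0 + i) \<le> phase_of R (t0 + j)"
    unfolding phase_of_def by (intro Max_mono) auto
  then show "envelope R q i \<le> envelope R q j"
    unfolding envelope_eq a_def by (intro monoD[OF mono_env_level]) linarith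
qed

lemma envelope_phase:
  assumes "i0 \<le> i" "i < j1" "tau R i \<le> t" "t < tau R (Suc i)"
  shows "envelope R q (t - t0) = a i"
proof -
  have "t0 \<le> t" using tau_le[of i0 i] i0 j1 assms by auto
  moreover have "phase_of R t = i" using assms i0 j1 by (intro phase_of_eq) auto
  ultimately show ?thesis using assms by (simp add: envelope_eq)
qed

text \<open>This covers the case \<open>Suc i = j1\<close> too, so the last step of the last paid
  phase sees the climb to the final level.\<close>

lemma envelope_next_phase:
  assumes "i0 \<le> i" "i < j1"
  shows "envelope R q (tau R (Suc i) - t0) = a (Suc i)"
proof -
  have "t0 \<le> tau R (Suc i)" using tau_le[of i0 "Suc i"] i0 j1 assms by auto
  moreover have "phase_of R (tau R (Suc i)) = Suc i"
    using assms i0 j1 tau_less[of "Suc i" "Suc (Suc i)"] by (intro phase_of_eq) auto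
  ultimately show ?thesis using assms by (simp add: envelope_eq)
qed

lemma envelope_0: "envelope R q 0 = real (b_init R q)"
  using envelope_phase[of i0 t0] i0 i0_less_j1 tau_less[of i0 "Suc i0"] a_i0 by simp

text \<open>An average is at most the maximum \<open>s_max\<close>, which is an integer and hence
  also bounds the ceiling; \<open>q\<close> is within one packet of it at \<open>t0\<close>.\<close>

lemma b_init_le_K: "b_init R q \<le> K"
proof -
  \<comment> \<open>A level of at least 2 excludes the default value 1 for an empty set.\<close>
  have ne: "live R q i0 \<noteq> {}" using c_ge[of i0] i0_less_j1 by (auto simp: c_def sigma_def)
  have "(\<Sum>p\<in>live R q i0. real (lqd R t0 p)) \<le> real (card (live R q i0)) * real (s_max R t0)"
    by (rule sum_bounded_above) (simp add: s_max_def)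
  then have "sigma R q i0 \<le> real (s_max R t0)"
    using ne by (simp add: sigma_def i0 divide_le_eq mult.commute card_gt_0_iff)
  then have "\<lceil>sigma R q i0\<rceil> \<le> int (s_max R t0)" by (simp add: ceiling_le_iff)
  then have "b_init R q \<le> lqd R t0 q"
    using lqd_t0_ge unfolding b_init_def i0_def[symmetric] by linarith
  then show ?thesis using lqd_t0_le_K by linarith
qed

section \<open>Summation over the paid phases\<close>

abbreviation g where "g t \<equiv> E t > 0 \<and> lqd R t q = 0"

text \<open>The shares \<open>P i\<close> of the phases are regrouped into contributions
  \<open>H j\<close> of single steps. These form the functional with repayment delayed to
  \<open>K\<close>, and \<open>D_le_delayed\<close> applies.\<close>

lemma L_total:
  "(\<Sum>i=i0..<j1. L_increase R \<alpha> \<beta> q i) \<ge> D \<alpha> (b_init R q) e (envelope R q) - 1/2"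
proof -
  define W where "W i = {tau R i..<tau R (Suc i)}" for i
  define P where "P i = (\<Sum>t\<in>W i. real (E t) / a i) - real (card {t \<in> W i. g t}) / (2 * a i) +
       \<alpha> * real (E (tau R (Suc i) - 1)) * ((a (Suc i) - a i) / a i)" for i
  define b where "b = envelope R q"
  define H where "H j = (\<alpha> * (b (j + 1) - b j) + 1) / b j * real (E (t0 + j))
       - (if g (t0 + j) then 1 / (2 * b j) else 0)" for j
  define M where "M = tau R j1 - t0"
  have tau: "tau R i < tau R (Suc i)" if "i0 \<le> i" "i < j1" for i
    using that i0 j1 by (intro tau_less) auto
  \<comment> \<open>The trivial conditional keeps the shape of the potential at
    \<open>i = j1\<close>, so that the rule unifies.\<close>
  have L_ge: "(\<Sum>i=i0..<j1. L_increase R \<alpha> \<beta> q i) \<ge> (\<Sum>i=i0..<j1. P i) -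
      (if j1 = j1 then 1/2 else real (E (tau R j1)) * (1 / c j1 - 1 / a j1))"
    unfolding P_def W_def
  proof (rule running_max_potential)
    fix i assume i: "i0 \<le> i" "i < j1"
    show "E (tau R i) > 0" using E_before_j1[of i] i i0 by simp
    have diff: "c (Suc i) - c i = sigma R q (Suc i) - sigma R q i" by (simp add: c_def)
    show "L_increase R \<alpha> \<beta> q i \<ge> (\<Sum>t\<in>{tau R i..<tau R (Suc i)}. real (E t) / c i) +
        \<alpha> * real (E (tau R (Suc i) - 1)) * ((c (Suc i) - c i) / c i)" if "c i \<le> c (Suc i)"
      unfolding diff using phase_fact[of i] i that by (simp add: c_def phase_steps_def)
    show "L_increase R \<alpha> \<beta> q i \<ge> (\<Sum>t\<in>{tau R i..<tau R (Suc i)}. real (E t) / c i) -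
        real (card {t \<in> {tau R i..<tau R (Suc i)}. g t}) / (2 * c i) -
        (if E (tau R (Suc i)) = 0 then 0 else real (E (tau R (Suc i))) * (1 / c (Suc i) - 1 / c i))"
      if "c (Suc i) < c i"
      using phase_fact[of i] i that beta by (simp add: c_def phase_steps_def g_steps_def cong: if_cong)
  qed (use tau a_Suc c_le_a_i0 c_ge j1 alpha i0_less_j1 in auto)
  have "P i = (\<Sum>t\<in>W i. H (t - t0))" if i: "i0 \<le> i" "i < j1" for i
  proof -
    have finW: "finite (W i)" by (simp add: W_def)
    \<comment> \<open>Only the last step \<open>l\<close> of a phase has a successor in another
      phase, so it alone carries the term with \<alpha>.\<close>
    define l where "l = tau R (Suc i) - 1"
    have l: "l \<in> W i" "Suc l = tau R (Suc i)" using tau[OF i] by (auto simp: l_def W_def)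
    have "H (t - t0) = real (E t) / a i - (if g t then 1 / (2 * a i) else 0) +
       (if t = l then \<alpha> * real (E l) * ((a (Suc i) - a i) / a i) else 0)" if t: "t \<in> W i" for t
    proof -
      have t0: "t0 \<le> t" using tau_le[of i0 i] t i i0 j1 by (auto simp: W_def)
      have bt: "b (t - t0) = a i" using envelope_phase[OF i] t by (simp add: b_def W_def)
      have "b (Suc t - t0) = (if t = l then a (Suc i) else a i)"
        using envelope_phase[OF i, of "Suc t"] envelope_next_phase[OF i] t l by (auto simp: b_def W_def)
      then have "b (t - t0 + 1) = (if t = l then a (Suc i) else a i)" using t0 by (simp add: Suc_diff_le)
      then show ?thesis using bt t0 by (auto simp: H_def add_divide_distrib distrib_left mult_ac)
    qed
    then have "(\<Sum>t\<in>W i. H (t - t0)) = (\<Sum>t\<in>W i. real (E t) / a i)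
        - (\<Sum>t\<in>W i. if g t then 1 / (2 * a i) else 0)
        + (\<Sum>t\<in>W i. if t = l then \<alpha> * real (E l) * ((a (Suc i) - a i) / a i) else 0)"
      by (simp add: sum.distrib sum_subtractf)
    also have "(\<Sum>t\<in>W i. if g t then 1 / (2 * a i) else 0) = real (card {t \<in> W i. g t}) / (2 * a i)"
      by (subst sum.inter_filter[OF finW, symmetric]) simp
    also have "(\<Sum>t\<in>W i. if t = l then \<alpha> * real (E l) * ((a (Suc i) - a i) / a i) else 0)
        = \<alpha> * real (E l) * ((a (Suc i) - a i) / a i)"
      using finW l by simp
    finally show ?thesis by (simp add: P_def l_def)
  qed
  then have "(\<Sum>i=i0..<j1. P i) = (\<Sum>i=i0..<j1. \<Sum>t\<in>{tau R i..<tau R (Suc i)}. H (t - t0))"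
    unfolding W_def by (intro sum.cong) auto
  also have "\<dots> = (\<Sum>t=t0..<tau R j1. H (t - t0))"
    using sum_concat[of i0 j1 "tau R"] tau i0 i0_less_j1 by (auto simp: less_imp_le)
  also have "\<dots> = (\<Sum>j=0..<M. H j)"
    using sum.shift_bounds_nat_ivl[of "\<lambda>t. H (t - t0)" 0 t0 M] tau_j1 by (simp add: M_def)
  also have "\<dots> = (\<Sum>j=0..<M. (\<alpha> * (b (j + 1) - b j) + 1) / b j * real (e - (j - K)))
      - (\<Sum>j=0..<M. if g (t0 + j) then 1 / (2 * b j) else 0)"
    by (simp add: H_def E_after sum_subtractf)
  also have "(\<Sum>j=0..<M. if g (t0 + j) then 1 / (2 * b j) else 0) = (\<Sum>j=K..<K+e. 1 / (2 * b j))"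
  proof -
    have g: "g (t0 + j) \<longleftrightarrow> K \<le> j \<and> j < K + e" for j
      using E_pos_iff[of "t0 + j"] before_K[of j] after_K[of j] by (cases "j < K") auto
    have "{0..<M} \<inter> {j. g (t0 + j)} = {K..<K+e}" using tau_j1 by (auto simp: g M_def)
    then show ?thesis by (simp only: sum.inter_restrict[symmetric] finite_atLeastLessThan
        sum.inter_filter[symmetric]) (simp add: Int_def)
  qed
  also have "(\<Sum>j=0..<M. (\<alpha> * (b (j + 1) - b j) + 1) / b j * real (e - (j - K)))
      - \<dots> \<ge> D \<alpha> (b_init R q) e b"
    using mono_envelope envelope_0 b_init_pos alpha b_init_le_K tau_j1
    by (intro D_le_delayed) (auto simp: b_def M_def)
  finally show ?thesis using L_ge by (simp add: b_def)
qed

text \<open>LQD transmits from \<open>q\<close> in each of the \<open>K\<close> steps from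
  \<open>t0\<close> on, and by \<open>tau_j1\<close> these all lie in paid phases.\<close>

lemma b_init_le_transmitted: "b_init R q \<le> (\<Sum>i=i0..<j1. transmitted R q i)"
proof -
  have tau: "tau R i \<le> tau R (Suc i)" if "i0 \<le> i" "i < j1" for i
    using that i0 j1 by (intro tau_le) auto
  have "K = (\<Sum>t=t0..<t0+K. of_bool (lqd R t q > 0))"
  proof -
    have "(\<Sum>t=t0..<t0+K. of_bool (lqd R t q > 0)) = (\<Sum>t=t0..<t0+K. 1::nat)"
    proof (rule sum.cong)
      fix t assume "t \<in> {t0..<t0+K}"
      then show "of_bool (lqd R t q > 0) = (1::nat)" using before_K[of "t - t0"] by auto
    qed simp
    then show ?thesis by simp
  qed
  also have "\<dots> \<le> (\<Sum>t=tau R i0..<tau R j1. of_bool (lqd R t q > 0))"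
    using tau_j1 i0 by (intro sum_mono2) auto
  also have "\<dots> = (\<Sum>i=i0..<j1. \<Sum>t\<in>{tau R i..<tau R (Suc i)}. of_bool (lqd R t q > 0))"
    by (rule sum_concat[THEN conjunct2, symmetric]) (use tau i0_less_j1 in auto)
  also have "\<dots> = (\<Sum>i=i0..<j1. transmitted R q i)"
    by (simp add: transmitted_def phase_steps_def Int_def)
  finally show ?thesis using b_init_le_K by simp
qed

lemma payment_ge:
  "payment R \<alpha> \<beta> q \<ge> (1 - \<alpha> - \<beta>) * real (b_init R q) + D \<alpha> (b_init R q) e (envelope R q) - 1/2"
proof -
  have "(1 - \<alpha> - \<beta>) * real (b_init R q) \<le> (1 - \<alpha> - \<beta>) * real (\<Sum>i=i0..<j1. transmitted R q i)"
    using b_init_le_transmitted alpha_beta by (intro mult_left_mono) (simp_all only: of_nat_le_iff)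
  then show ?thesis
    using L_total by (simp add: payment_def paid S_increase_def sum.distrib sum_distrib_left)
qed

lemma envelope_in_monotone_seqs: "envelope R q \<in> monotone_seqs (b_init R q) m"
  using mono_envelope envelope_0 by (auto simp: monotone_seqs_def mono_on_def mono_def)

end

theorem corollary5p3:
  fixes R :: "'q::finite run" and \<alpha> \<beta> :: real
  assumes "valid_run R" and "A1 R" and "valid_mapping R"
    and "\<alpha> \<in> {0<..<1}" and "\<beta> \<in> {0<..<1}"
    and "1/2 \<le> \<alpha>" and "\<alpha> \<le> 2/3" and "\<alpha> + \<beta> < 1"
    and "\<beta> \<ge> 1 - sqrt (1 - \<alpha>) - \<alpha> / 2"
    and "per_phase_facts R \<alpha> \<beta>"
  shows "\<forall>q. hat_e R q > 0 \<longrightarrow>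
    payment R \<alpha> \<beta> q \<ge>
      (1 - \<alpha> - \<beta>) * real (b_init R q) + D \<alpha> (b_init R q) (hat_e R q) (envelope R q) - 1/2 \<and>
    payment R \<alpha> \<beta> q \<ge>
      (1 - \<alpha> - \<beta>) * real (b_init R q) +
      (INF b\<in>monotone_seqs (b_init R q) (b_init R q + hat_e R q).
         D \<alpha> (b_init R q) (hat_e R q) b) - 1/2"
proof (intro allI impI)
  fix q assume "hat_e R q > 0"
  then interpret paid_queue R q \<alpha> \<beta>
    using assms by unfold_locales auto
  \<comment> \<open>The envelope is one of the competing sequences.\<close>
  have "(INF b\<in>monotone_seqs (b_init R q) (b_init R q + e). D \<alpha> (b_init R q) e b)
      \<le> D \<alpha> (b_init R q) e (envelope R q)"
    by (rule cINF_lower[OF bdd_below_D[OF b_init_pos alpha] envelope_in_monotone_seqs])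
  with payment_ge show "payment R \<alpha> \<beta> q \<ge>
      (1 - \<alpha> - \<beta>) * real (b_init R q) + D \<alpha> (b_init R q) (hat_e R q) (envelope R q) - 1/2 \<and>
    payment R \<alpha> \<beta> q \<ge>
      (1 - \<alpha> - \<beta>) * real (b_init R q) +
      (INF b\<in>monotone_seqs (b_init R q) (b_init R q + hat_e R q).
         D \<alpha> (b_init R q) (hat_e R q) b) - 1/2"
    unfolding e_def by linarith
qed

end
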